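(* Let $m\ge 2$, $n\ge1$, let $A\in\mathbb{R}^{n\times n}$ be diagonalizable over $\mathbb{C}$ with $r\ge1$ eigenvalues (counted with multiplicity) in the open right half plane $\mathbb{C}^+$, and let $B\in\mathbb{R}^{n\times n_B}$, $n_B<n$, be such that $(A,B)$ is stabilizable. Let $Q$ be an invertible matrix whose columns are eigenvectors of $A$, ordered so that $S:=Q^{-1}AQ=\mathrm{diag}(\lambda_A^1,\dots,\lambda_A^n)$ with $\mathrm{Re}(\lambda_A^1)\ge\cdots\ge \mathrm{Re}(\lambda_A^n)$, $\lambda_A^1,\dots,\lambda_A^r\in\mathbb{C}^+$, and $\lambda_A^{r+1},\dots,\lambda_A^n$ in the closed left half plane. Let $\Omega=\{\mathcal{L}^1,\dots,\mathcal{L}^v\}$ be a finite set of Laplacian matrices, each $\mathcal{L}^i$ being the Laplacian of a strongly connected directed weighted graph $G_i$ on $\{1,\dots,m\}$, and fix $\underline{h}>0$. For $\gamma>0$ let $\Gamma=\mathrm{diag}(\gamma^1,\dots,\gamma^n)$ with $\gamma^1=\cdots=\gamma^r=\gamma$ and $\gamma^{r+1}=\cdots=\gamma^n=1$, and consider the multi-agent system $$\dot{x}_i(t)=S x_i(t)+\Gamma\sum_{j=1}^m\alpha_{ij}(t)\,(x_j(t)-x_i(t)),\qquad i=1,\dots,m,$$ where the Laplacian $\mathcal{L}(t)$ of the weights $\alpha_{ij}(t)$ satisfies $\mathcal{L}(t)=\mathcal{L}^{\sigma(t)}\in\Omega$ for all $t$, with $\sigma$ an arbitrary admissible switching signal with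 dwell time $\underline{h}$. Then the system reaches consensus exponentially when $\gamma$ is sufficiently large; that is, there exists $\gamma^*>0$ such that for every $\gamma\ge\gamma^*$ and every admissible switching signal $\sigma$, the system reaches consensus exponentially.
   Context: Graphs: a weighted directed graph on $\{1,\dots,m\}$ has weights $\alpha_{ij}\ge0$ ($i\ne j$); $(i,j)$ is an edge iff $\alpha_{ij}>0$, meaning that $j$ is an in-neighbor of $i$ (the edge is directed from $j$ to $i$). It is strongly connected if for every ordered pair of nodes there is a directed path from the first to the second. The Laplacian has $\mathcal{L}_{ij}=-\alpha_{ij}$ for $i\neq j$ and $\mathcal{L}_{ii}=\sum_{j\ne i}\alpha_{ij}$. Admissible switching signal with dwell time $\underline{h}$: a function $\sigma:[0,\infty)\to\{1,\dots,v\}$ for which there are instants $0=t_0<t_1<t_2<\cdots$ with $t_{k+1}-t_k\ge\underline{h}$ for all $k$, such that $\sigma$ is constant on each $[t_k,t_{k+1})$ (consecutive values are allowed to coincide). Consensus: the states are $x_i(t)\in\mathbb{C}^n$. For a given switching signal, the system reaches consensus exponentially if there are $c,\mu>0$ such that for all initial conditions, $\|x_i(t)-x_j(t)\|\le c\,e^{-\mu t}\max_k\|x_k(0)\|$ for all $t\ge0$ and all $i,j$. Background: the system is the transformed form of agents $\dot w_i=Aw_i+Bu_i$, all of whose states are assumed measurable. The matrix $B$ does not appear in the system in the claim. *)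

theory Defs
  imports "HOL-Analysis.Analysis" "HOL-Computational_Algebra.Computational_Algebra"
begin

definition cmat :: "real^'n^'m \<Rightarrow> complex^'n^'m" where
  "cmat M = map_matrix complex_of_real M"

definition diag_mat :: "('n::finite \<Rightarrow> complex) \<Rightarrow> complex^'n^'n" where
  "diag_mat d = (\<chi> i j. if i = j then d i else 0)"

definition is_eigenvector :: "complex^'n^'n \<Rightarrow> complex^'n \<Rightarrow> bool" where
  "is_eigenvector M v \<longleftrightarrow> v \<noteq> 0 \<and> (\<exists>z. M *v v = z *s v)"

definition is_eigenvalue :: "complex^'n^'n \<Rightarrow> complex \<Rightarrow> bool" where
  "is_eigenvalue M z \<longleftrightarrow> (\<exists>v. v \<noteq> 0 \<and> M *v v = z *s v)"

definition diagonalizable_over_C :: "real^'n^'n \<Rightarrow> bool" where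
  "diagonalizable_over_C A \<longleftrightarrow>
     (\<exists>(P :: complex^'n^'n) d. invertible P \<and> matrix_inv P ** cmat A ** P = diag_mat d)"

definition charpoly :: "complex^'n^'n \<Rightarrow> complex poly" where
  "charpoly M = det (mat [:0, 1:] - map_matrix (\<lambda>c. [:c:]) M)"

text \<open>Number of eigenvalues in the open right half plane, counted with algebraic multiplicity.\<close>

definition num_unstable_eigenvalues :: "real^'n^'n \<Rightarrow> nat" where
  "num_unstable_eigenvalues A = size {# z \<in># proots (charpoly (cmat A)). Re z > 0 #}"

definition hurwitz :: "real^'n^'n \<Rightarrow> bool" where
  "hurwitz M \<longleftrightarrow> (\<forall>z. is_eigenvalue (cmat M) z \<longrightarrow> Re z < 0)"

text \<open>Continuous-time stabilizability: some static state feedback \<open>u = K w\<close>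
  makes \<open>w' = A w + B u\<close> asymptotically stable.\<close>

definition stabilizable :: "real^'n^'n \<Rightarrow> real^'b^'n \<Rightarrow> bool" where
  "stabilizable A B \<longleftrightarrow> (\<exists>K :: real^'n^'b. hurwitz (A + B ** K))"

text \<open>The index set \<open>{1,\<dots>,n}\<close> is represented by a finite linearly ordered type;
  \<open>position k\<close> is the number of the index \<open>k\<close>, counted from 1.\<close>

definition position :: "'n::{finite,linorder} \<Rightarrow> nat" where
  "position k = card {j. j \<le> k}"

text \<open>A weighted digraph on the node type is given by its weights \<open>\<alpha> i j\<close> for \<open>i \<noteq> j\<close>;
  diagonal values of \<open>\<alpha>\<close> carry no meaning and are ignored throughout.\<close>

definition weighted_digraph :: "('m \<Rightarrow> 'm \<Rightarrow> real) \<Rightarrow> bool" where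
  "weighted_digraph \<alpha> \<longleftrightarrow> (\<forall>i j. i \<noteq> j \<longrightarrow> \<alpha> i j \<ge> 0)"

text \<open>A positive weight \<open>\<alpha> i j\<close> is an edge directed from \<open>j\<close> to \<open>i\<close>.\<close>

definition edges :: "('m \<Rightarrow> 'm \<Rightarrow> real) \<Rightarrow> ('m \<times> 'm) set" where
  "edges \<alpha> = {(j, i). i \<noteq> j \<and> \<alpha> i j > 0}"

definition strongly_connected :: "('m \<Rightarrow> 'm \<Rightarrow> real) \<Rightarrow> bool" where
  "strongly_connected \<alpha> \<longleftrightarrow> (\<forall>i j. (i, j) \<in> (edges \<alpha>)\<^sup>*)"

definition laplacian :: "('m::finite \<Rightarrow> 'm \<Rightarrow> real) \<Rightarrow> real^'m^'m" where
  "laplacian \<alpha> = (\<chi> i j. if i = j then (\<Sum>k\<in>UNIV - {i}. \<alpha> i k) else - \<alpha> i j)"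

text \<open>Signals with values in \<open>{1,\<dots>,v}\<close>; only their values at times \<open>t \<ge> 0\<close> are relevant.\<close>

definition admissible_signal :: "nat \<Rightarrow> real \<Rightarrow> (real \<Rightarrow> nat) \<Rightarrow> bool" where
  "admissible_signal v h \<sigma> \<longleftrightarrow>
     (\<forall>t\<ge>0. \<sigma> t \<in> {1..v}) \<and>
     (\<exists>ts :: nat \<Rightarrow> real. ts 0 = 0 \<and> strict_mono ts \<and>
        (\<forall>k. ts (Suc k) - ts k \<ge> h) \<and>
        (\<forall>k. \<forall>s\<in>{ts k..<ts (Suc k)}. \<sigma> s = \<sigma> (ts k)))"

definition gain_matrix :: "nat \<Rightarrow> real \<Rightarrow> complex^('n::{finite,linorder})^('n::{finite,linorder})" where
  "gain_matrix r \<gamma> = diag_mat (\<lambda>k. complex_of_real (if position k \<le> r then \<gamma> else 1))"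

text \<open>The right-hand side is piecewise continuous in time, so trajectories are continuous
  and satisfy the differential equation outside a locally finite set of instants.\<close>

definition trajectory ::
  "complex^'n^'n \<Rightarrow> complex^'n^'n \<Rightarrow> (real \<Rightarrow> 'm::finite \<Rightarrow> 'm \<Rightarrow> real) \<Rightarrow> ('m \<Rightarrow> real \<Rightarrow> complex^'n) \<Rightarrow> bool"
  where
  "trajectory S \<Gamma> \<alpha> x \<longleftrightarrow>
     (\<forall>i. continuous_on {0..} (x i)) \<and>
     (\<exists>D :: real set. (\<forall>T. finite (D \<inter> {0..T})) \<and>
        (\<forall>t\<in>{0..} - D. \<forall>i.
           (x i has_vector_derivative
              (S *v x i t + \<Gamma> *v (\<Sum>j\<in>UNIV. \<alpha> t i j *\<^sub>R (x j t - x i t))))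
           (at t within {0..})))"

definition consensus_exponentially ::
  "complex^'n^'n \<Rightarrow> complex^'n^'n \<Rightarrow> (real \<Rightarrow> 'm::finite \<Rightarrow> 'm \<Rightarrow> real) \<Rightarrow> bool"
  where
  "consensus_exponentially S \<Gamma> \<alpha> \<longleftrightarrow>
     (\<exists>c>0. \<exists>\<mu>>0. \<forall>x. trajectory S \<Gamma> \<alpha> x \<longrightarrow>
        (\<forall>t\<ge>0. \<forall>i j. norm (x i t - x j t)
            \<le> c * exp (- \<mu> * t) * Max (range (\<lambda>k. norm (x k 0)))))"

end

theory Submission
  imports Defs
begin

text \<open>
  Since \<open>S\<close> and \<open>\<Gamma>\<close> are diagonal, the coordinates decouple, and
  \<open>z i t = exp (- lam k * t) * x i t $ k\<close> obeys pure averaging dynamics with weights scaled by the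
  gain \<open>g\<close>. There the maximum never increases and the minimum never decreases; in
  every time window of length proportional to \<open>1 / g\<close>, mass spreads from the extreme node to one
  further node at a time, so the range of the real and imaginary parts shrinks by a factor
  independent of the switching signal. Hence disagreement in
  coordinate \<open>k\<close> is \<open>O (exp ((Re (lam k) - \<mu> * g) * t))\<close> with \<open>\<mu> > 0\<close> independent of \<open>g\<close>: gain 1 suffices
  where \<open>Re (lam k) \<le> 0\<close>, and a large gain beats \<open>Re (lam k) > 0\<close>.
\<close>

section \<open>Differential inequalities with finitely many exceptional times\<close>

text \<open>The increment \<open>f b - f a\<close> is the integral of a nonnegative function: the
  fundamental theorem of calculus tolerates a finite exceptional set as long as \<open>f\<close> is
  continuous. This is what carries the argument across switching instants.\<close>

lemma nondecreasing_if_deriv_nonneg_except_finite: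
  fixes f :: "real \<Rightarrow> real"
  assumes "a \<le> b" "continuous_on {a..b} f" "finite D"
    and deriv: "\<And>t. a < t \<Longrightarrow> t < b \<Longrightarrow> t \<notin> D \<Longrightarrow> \<exists>y\<ge>0. (f has_real_derivative y) (at t)"
  shows "f a \<le> f b"
proof -
  have "\<forall>t\<in>{a<..<b} - D. \<exists>y. y \<ge> 0 \<and> (f has_real_derivative y) (at t)"
    using deriv by simp
  from bchoice[OF this] obtain f' where "\<forall>t\<in>{a<..<b} - D. f' t \<ge> 0 \<and> (f has_real_derivative f' t) (at t)"
    ..
  then have f': "\<And>t. a < t \<Longrightarrow> t < b \<Longrightarrow> t \<notin> D \<Longrightarrow>
      f' t \<ge> 0 \<and> (f has_real_derivative f' t) (at t)"
    by simp
  \<comment> \<open>The value 0 at endpoints and exceptional points keeps the integrand nonnegative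
    everywhere.\<close>
  define g where "g = (\<lambda>t. if a < t \<and> t < b \<and> t \<notin> D then f' t else 0)"
  have g: "g t \<ge> 0" for t
    using f' by (simp add: g_def)
  have "(f has_vector_derivative g t) (at t)" if "t \<in> {a<..<b} - D" for t
    using f'[of t] that by (simp add: g_def flip: has_real_derivative_iff_has_vector_derivative)
  then have "(g has_integral (f b - f a)) {a..b}"
    by (rule fundamental_theorem_of_calculus_interior_strong[OF \<open>finite D\<close> assms(1) _ assms(2)])
  then have "0 \<le> f b - f a"
    by (rule has_integral_nonneg) (rule g)
  then show ?thesis by simp
qed

text \<open>Multiplication by the integrating factor \<open>exp (K * (\<tau> - s))\<close> turns the
  forcing term into the constant \<open>b\<close>, so the product minus
  \<open>b * (\<tau> - s)\<close> is nondecreasing. The sign of \<open>K\<close> is free: growth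
  bounds use a negative \<open>K\<close>, decay bounds a positive one.\<close>

lemma linear_comparison:
  fixes f :: "real \<Rightarrow> real"
  assumes "s \<le> t" "continuous_on {s..t} f" "finite D"
    and deriv: "\<And>\<tau>. s < \<tau> \<Longrightarrow> \<tau> < t \<Longrightarrow> \<tau> \<notin> D \<Longrightarrow>
      \<exists>y. (f has_real_derivative y) (at \<tau>) \<and> y \<ge> b * exp (- K * (\<tau> - s)) - K * f \<tau>"
  shows "f s + b * (t - s) \<le> exp (K * (t - s)) * f t"
proof -
  let ?F = "\<lambda>\<tau>. exp (K * (\<tau> - s)) * f \<tau> - b * (\<tau> - s)"
  have "?F s \<le> ?F t"
  proof (rule nondecreasing_if_deriv_nonneg_except_finite[OF assms(1) _ assms(3)])
    show "continuous_on {s..t} ?F"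
      by (intro continuous_intros assms)
  next
    fix \<tau> assume "s < \<tau>" "\<tau> < t" "\<tau> \<notin> D"
    then obtain y where y: "(f has_real_derivative y) (at \<tau>)"
      "y \<ge> b * exp (- K * (\<tau> - s)) - K * f \<tau>" using deriv by blast
    have der: "(?F has_real_derivative (exp (K * (\<tau> - s)) * (y + K * f \<tau>) - b)) (at \<tau>)"
      by (rule derivative_eq_intros y(1) refl | simp add: algebra_simps)+
    have "exp (K * (\<tau> - s)) * (b * exp (- K * (\<tau> - s))) = b"
      by (simp add: exp_minus)
    moreover have "exp (K * (\<tau> - s)) * (b * exp (- K * (\<tau> - s))) \<le> exp (K * (\<tau> - s)) * (y + K * f \<tau>)"
      using y(2) by (intro mult_left_mono) auto
    ultimately have "b \<le> exp (K * (\<tau> - s)) * (y + K * f \<tau>)" by linarith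
    with der show "\<exists>y\<ge>0. (?F has_real_derivative y) (at \<tau>)"
      by (intro exI[of _ "exp (K * (\<tau> - s)) * (y + K * f \<tau>) - b"]) simp
  qed
  then show ?thesis by simp
qed

text \<open>Squaring removes the kink of the negative part: at 0 the difference quotient is at most
  \<open>\<bar>h\<bar>\<close>. This makes the energy used for invariance of nonnegativity
  differentiable.\<close>

lemma DERIV_negative_part_squared:
  "((\<lambda>x::real. (min x 0)\<^sup>2) has_real_derivative (2 * min x 0)) (at x)"
proof (cases "x = 0")
  case True
  have "((\<lambda>h::real. (min h 0)\<^sup>2 / h) \<longlongrightarrow> 0) (at 0)"
  proof (rule Lim_null_comparison[where g = "\<lambda>h. \<bar>h\<bar>"])
    show "\<forall>\<^sub>F h::real in at 0. norm ((min h 0)\<^sup>2 / h) \<le> \<bar>h\<bar>"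
      by (rule always_eventually) (auto simp: min_def power2_eq_square)
    show "((\<lambda>h::real. \<bar>h\<bar>) \<longlongrightarrow> 0) (at 0)"
      by (auto intro!: tendsto_eq_intros)
  qed
  then show ?thesis using True by (simp add: DERIV_def)
next
  case False
  consider "x < 0" | "x > 0" using False by linarith
  then show ?thesis
  proof cases
    case 1
    have "((\<lambda>x::real. x\<^sup>2) has_real_derivative (2 * min x 0)) (at x)"
      using 1 by (auto intro!: derivative_eq_intros)
    then show ?thesis
      by (rule has_field_derivative_transform_within_open[of _ _ _ "{..<0}"]) (use 1 in auto)
  next
    case 2
    have "((\<lambda>x::real. 0) has_real_derivative (2 * min x 0)) (at x)"
      using 2 by auto
    then show ?thesis
      by (rule has_field_derivative_transform_within_open[of _ _ _ "{0<..}"]) (use 2 in auto)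
  qed
qed

section \<open>Averaging dynamics under time-varying weights\<close>

text \<open>Fraction of a lower bound that survives one window of length \<open>\<delta>\<close>: an
  inflow of at least \<open>a\<close> across a cut, discounted by the outflow rate \<open>d\<close>
  and shared among at most \<open>N\<close> nodes. For fixed \<open>N\<close> it depends only on
  \<open>a * \<delta>\<close> and \<open>d * \<delta>\<close>, so it is invariant under rescaling
  time.\<close>

definition spread_rate :: "nat \<Rightarrow> real \<Rightarrow> real \<Rightarrow> real \<Rightarrow> real" where
  "spread_rate N a d \<delta> = a * \<delta> * exp (- d * \<delta>) / N"

lemma spread_rate_pos: "0 < N \<Longrightarrow> 0 < a \<Longrightarrow> 0 < \<delta> \<Longrightarrow> 0 < spread_rate N a d \<delta>"
  by (simp add: spread_rate_def)

text \<open>A node keeps at least the fraction \<open>exp (- d * \<delta>)\<close> of its own value,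
  so the same rate serves the nodes already reached and the newly reached one.\<close>

lemma spread_rate_le_exp:
  assumes "0 < N" "a * \<delta> \<le> 1"
  shows "spread_rate N a d \<delta> \<le> exp (- d * \<delta>)"
proof -
  have "a * \<delta> \<le> N"
    by (rule order_trans[OF assms(2)]) (use assms(1) in simp)
  then show ?thesis
    using assms(1) by (simp add: spread_rate_def field_simps)
qed

text \<open>Connectivity enters as a lower bound on the weight into the complement of every proper
  nonempty set of nodes; unlike a condition on particular edges, this bound is the same for all
  graphs of the family. The set \<open>D\<close> holds the times at which the differential equation
  may fail.\<close>

locale averaging =
  fixes w :: "real \<Rightarrow> 'm::finite \<Rightarrow> 'm \<Rightarrow> real" and a d :: real and D :: "real set"
  assumes w_nonneg: "t \<ge> 0 \<Longrightarrow> 0 \<le> w t i j"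
    and row_sum: "t \<ge> 0 \<Longrightarrow> (\<Sum>j\<in>UNIV. w t i j) \<le> d"
    and cut: "t \<ge> 0 \<Longrightarrow> X \<noteq> {} \<Longrightarrow> X \<noteq> UNIV \<Longrightarrow> a \<le> (\<Sum>i\<in>-X. \<Sum>j\<in>X. w t i j)"
    and a_pos: "a > 0"
    and locally_finite: "finite (D \<inter> {0..T})"
begin

definition solution :: "('m \<Rightarrow> real \<Rightarrow> real) \<Rightarrow> bool" where
  "solution z \<longleftrightarrow> (\<forall>i. continuous_on {0..} (z i)) \<and>
     (\<forall>t>0. t \<notin> D \<longrightarrow> (\<forall>i. (z i has_real_derivative (\<Sum>j\<in>UNIV. w t i j * (z j t - z i t))) (at t)))"

lemma solution_continuous_on: "solution z \<Longrightarrow> s \<ge> 0 \<Longrightarrow> continuous_on {s..t} (z i)"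
  unfolding solution_def by (auto intro: continuous_on_subset)

lemma solution_deriv:
  "solution z \<Longrightarrow> t > 0 \<Longrightarrow> t \<notin> D \<Longrightarrow>
     (z i has_real_derivative (\<Sum>j\<in>UNIV. w t i j * (z j t - z i t))) (at t)"
  by (auto simp: solution_def)

text \<open>The dynamics are linear and see only differences. Translation and reflection let results
  on nonnegative solutions give both lower and upper bounds.\<close>

lemma solution_affine:
  assumes "solution z"
  shows "solution (\<lambda>i t. c + b * z i t)"
  unfolding solution_def
proof (intro conjI allI impI)
  show "continuous_on {0..} (\<lambda>t. c + b * z i t)" for i
    using assms unfolding solution_def by (intro continuous_intros) auto
next
  fix t :: real and i assume "t > 0" "t \<notin> D"
  then have "((\<lambda>t. c + b * z i t) has_real_derivative b * (\<Sum>j\<in>UNIV. w t i j * (z j t - z i t))) (at t)"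
    by (auto intro!: derivative_eq_intros solution_deriv[OF assms])
  then show "((\<lambda>t. c + b * z i t) has_real_derivative
      (\<Sum>j\<in>UNIV. w t i j * (c + b * z j t - (c + b * z i t)))) (at t)"
    by (simp add: sum_distrib_left algebra_simps)
qed

lemma solution_diff_const: "solution z \<Longrightarrow> solution (\<lambda>i t. z i t - c)"
  using solution_affine[of z "- c" 1] by simp

lemma solution_const_diff: "solution z \<Longrightarrow> solution (\<lambda>i t. c - z i t)"
  using solution_affine[of z c "- 1"] by simp

lemma d_nonneg: "0 \<le> d"
proof -
  have "0 \<le> (\<Sum>j\<in>UNIV. w 0 undefined j)" by (intro sum_nonneg w_nonneg) auto
  then show ?thesis using row_sum[of 0 undefined] by linarith
qed

text \<open>The energy \<open>W\<close>, the sum of squared negative parts, vanishes at time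
  \<open>s\<close> and grows at most at the relative rate \<open>2 * d * N\<close>, with
  \<open>N\<close> the number of nodes; hence it stays 0. It replaces the minimum over the nodes,
  which need not be differentiable.\<close>

lemma nonneg_invariant:
  assumes u: "solution u" and "0 \<le> s" "s \<le> t" and init: "\<And>i. 0 \<le> u i s"
  shows "0 \<le> u i t"
proof -
  define W where "W = (\<lambda>t. \<Sum>i\<in>UNIV. (min (u i t) 0)\<^sup>2)"
  let ?N = "real CARD('m)"
  \<comment> \<open>The comparison lemma bounds from below, so \<open>W\<close> enters negated, with
    a negative \<open>K\<close> and no forcing.\<close>
  have "- W s + 0 * (t - s) \<le> exp (- (2 * d * ?N) * (t - s)) * (- W t)"
  proof (rule linear_comparison[where D = "D \<inter> {0..t}"])
    show "continuous_on {s..t} (\<lambda>t. - W t)"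
      unfolding W_def using solution_continuous_on[OF u \<open>0 \<le> s\<close>]
      by (intro continuous_intros)
  next
    fix \<tau> assume \<tau>: "s < \<tau>" "\<tau> < t" "\<tau> \<notin> D \<inter> {0..t}"
    then have pos: "\<tau> > 0" "\<tau> \<notin> D" using \<open>0 \<le> s\<close> by auto
    define n where "n i = min (u i \<tau>) 0" for i
    let ?y = "\<Sum>i\<in>UNIV. 2 * n i * (\<Sum>j\<in>UNIV. w \<tau> i j * (u j \<tau> - u i \<tau>))"
    have "(W has_real_derivative ?y) (at \<tau>)"
      unfolding W_def n_def
      by (intro DERIV_sum DERIV_chain2[OF DERIV_negative_part_squared] solution_deriv[OF u] pos)
    then have der: "((\<lambda>t. - W t) has_real_derivative (- ?y)) (at \<tau>)"
      by (rule DERIV_minus)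
    \<comment> \<open>Since \<open>n i\<close> is nonpositive and \<open>n j\<close> is at most
      \<open>u j \<tau>\<close>, replacing \<open>u j \<tau>\<close> by \<open>n j\<close> only
      increases the product, while the term with \<open>u i \<tau>\<close> has the favourable sign;
      the rest is the inequality between product and squares.\<close>
    have summand: "2 * n i * (w \<tau> i j * (u j \<tau> - u i \<tau>)) \<le> d * ((n i)\<^sup>2 + (n j)\<^sup>2)" for i j
    proof -
      have "w \<tau> i j \<le> (\<Sum>j\<in>UNIV. w \<tau> i j)"
        using pos by (intro member_le_sum w_nonneg) auto
      then have w: "0 \<le> w \<tau> i j" "w \<tau> i j \<le> d"
        using row_sum[of \<tau> i] w_nonneg[of \<tau> i j] pos by auto
      have "n i * u j \<tau> \<le> n i * n j"
        by (rule mult_left_mono_neg) (auto simp: n_def)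
      moreover have "n i * u i \<tau> \<ge> 0"
        by (auto simp: n_def min_def mult_nonpos_nonpos)
      moreover have "2 * (n i * n j) \<le> (n i)\<^sup>2 + (n j)\<^sup>2"
        using sum_squares_bound[of "n i" "n j"] by (simp add: mult.assoc)
      ultimately have "2 * n i * (u j \<tau> - u i \<tau>) \<le> (n i)\<^sup>2 + (n j)\<^sup>2"
        by (simp add: algebra_simps)
      then have "w \<tau> i j * (2 * n i * (u j \<tau> - u i \<tau>)) \<le> w \<tau> i j * ((n i)\<^sup>2 + (n j)\<^sup>2)"
        using w by (intro mult_left_mono) auto
      also have "\<dots> \<le> d * ((n i)\<^sup>2 + (n j)\<^sup>2)"
        using w by (intro mult_right_mono) auto
      finally show ?thesis by (simp add: algebra_simps)
    qed
    have "?y \<le> (\<Sum>i\<in>UNIV. \<Sum>j\<in>UNIV. d * ((n i)\<^sup>2 + (n j)\<^sup>2))"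
      unfolding sum_distrib_left by (intro sum_mono summand)
    also have "\<dots> = 2 * d * ?N * W \<tau>"
      by (simp add: W_def n_def sum.distrib sum_distrib_left[symmetric] algebra_simps)
    finally show "\<exists>y. ((\<lambda>t. - W t) has_real_derivative y) (at \<tau>) \<and>
        y \<ge> 0 * exp (- (- (2 * d * ?N)) * (\<tau> - s)) - (- (2 * d * ?N)) * (- W \<tau>)"
      using der by (intro exI[of _ "- ?y"]) auto
  qed (simp_all add: locally_finite assms(3))
  moreover have "W s = 0"
    using init by (simp add: W_def)
  ultimately have "W t \<le> 0"
    by (simp add: mult_le_0_iff)
  moreover have "(min (u i t) 0)\<^sup>2 \<le> W t"
    unfolding W_def by (rule member_le_sum) auto
  ultimately have "(min (u i t) 0)\<^sup>2 \<le> 0" by linarith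
  then show ?thesis by (simp add: min_def split: if_splits)
qed

lemma node_decay:
  assumes u: "solution u" and nonneg: "\<And>i t. t \<ge> s \<Longrightarrow> 0 \<le> u i t" and "0 \<le> s" "s \<le> t"
  shows "exp (- d * (t - s)) * u i s \<le> u i t"
proof -
  have "u i s + 0 * (t - s) \<le> exp (d * (t - s)) * u i t"
  proof (rule linear_comparison[where D = "D \<inter> {0..t}"])
    fix \<tau> assume \<tau>: "s < \<tau>" "\<tau> < t" "\<tau> \<notin> D \<inter> {0..t}"
    then have pos: "\<tau> > 0" "\<tau> \<notin> D" using \<open>0 \<le> s\<close> by auto
    have "(\<Sum>j\<in>UNIV. w \<tau> i j * (u j \<tau> - u i \<tau>)) =
        (\<Sum>j\<in>UNIV. w \<tau> i j * u j \<tau>) - (\<Sum>j\<in>UNIV. w \<tau> i j) * u i \<tau>"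
      by (simp add: algebra_simps sum_subtractf sum_distrib_left)
    moreover have "(\<Sum>j\<in>UNIV. w \<tau> i j * u j \<tau>) \<ge> 0"
      using \<tau> pos nonneg by (intro sum_nonneg mult_nonneg_nonneg w_nonneg) auto
    moreover have "(\<Sum>j\<in>UNIV. w \<tau> i j) * u i \<tau> \<le> d * u i \<tau>"
      using \<tau> pos nonneg by (intro mult_right_mono row_sum) auto
    ultimately show "\<exists>y. (u i has_real_derivative y) (at \<tau>) \<and>
        y \<ge> 0 * exp (- d * (\<tau> - s)) - d * u i \<tau>"
      using solution_deriv[OF u pos] by (intro exI conjI) (assumption, simp)
  qed (simp_all add: locally_finite solution_continuous_on[OF u] assms(3,4))
  then show ?thesis by (simp add: exp_minus divide_inverse[symmetric] pos_divide_le_eq mult.commute)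
qed

text \<open>Since every cut carries weight at least \<open>a\<close> at every time, the total mass outside \<open>X\<close>
  grows even if the edges crossing the cut change arbitrarily.\<close>

lemma spread_step:
  fixes \<delta> :: real
  assumes u: "solution u" and nonneg: "\<And>i t. t \<ge> s \<Longrightarrow> 0 \<le> u i t"
    and "0 \<le> s" "0 \<le> \<delta>" and aD: "a * \<delta> \<le> 1" and "0 \<le> c"
    and X: "X \<noteq> {}" "X \<noteq> UNIV" "\<And>i. i \<in> X \<Longrightarrow> c \<le> u i s"
  defines "\<kappa> \<equiv> spread_rate CARD('m) a d \<delta>"
  shows "\<exists>k. k \<notin> X \<and> (\<forall>i\<in>insert k X. \<kappa> * c \<le> u i (s + \<delta>))"
proof -
  let ?v = "\<lambda>t. \<Sum>i\<in>-X. u i t"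
  let ?t = "s + \<delta>"
  have stay: "c * exp (- d * (\<tau> - s)) \<le> u i \<tau>" if "i \<in> X" "s \<le> \<tau>" for i \<tau>
  proof -
    have "exp (- d * (\<tau> - s)) * c \<le> exp (- d * (\<tau> - s)) * u i s"
      using X(3)[OF that(1)] by (intro mult_left_mono) auto
    also have "\<dots> \<le> u i \<tau>" using node_decay[OF u nonneg \<open>0 \<le> s\<close> that(2)] by auto
    finally show ?thesis by (simp add: mult.commute)
  qed
  \<comment> \<open>While the nodes of \<open>X\<close> hold at least
    \<open>c * exp (- d * (\<tau> - s))\<close>, the mass outside gains at least \<open>a\<close>
    times that and loses at most \<open>d\<close> times itself: exactly the forcing shape of the
    comparison lemma.\<close>
  have "?v s + (a * c) * (?t - s) \<le> exp (d * (?t - s)) * ?v ?t"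
  proof (rule linear_comparison[where D = "D \<inter> {0..?t}"])
    show "continuous_on {s..?t} ?v"
      using solution_continuous_on[OF u \<open>0 \<le> s\<close>] by (intro continuous_intros)
  next
    fix \<tau> assume \<tau>: "s < \<tau>" "\<tau> < ?t" "\<tau> \<notin> D \<inter> {0..?t}"
    then have pos: "\<tau> > 0" "\<tau> \<notin> D" using \<open>0 \<le> s\<close> by auto
    let ?y = "\<Sum>i\<in>-X. \<Sum>j\<in>UNIV. w \<tau> i j * (u j \<tau> - u i \<tau>)"
    have der: "(?v has_real_derivative ?y) (at \<tau>)"
      by (intro DERIV_sum solution_deriv[OF u] pos)
    have "?y \<ge> (\<Sum>i\<in>-X. (\<Sum>j\<in>X. w \<tau> i j) * (c * exp (- d * (\<tau> - s))) - d * u i \<tau>)"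
    proof (rule sum_mono)
      fix i
      have "(\<Sum>j\<in>UNIV. w \<tau> i j * (u j \<tau> - u i \<tau>)) =
          (\<Sum>j\<in>UNIV. w \<tau> i j * u j \<tau>) - (\<Sum>j\<in>UNIV. w \<tau> i j) * u i \<tau>"
        by (simp add: algebra_simps sum_subtractf sum_distrib_left)
      moreover have "(\<Sum>j\<in>X. w \<tau> i j) * (c * exp (- d * (\<tau> - s))) \<le> (\<Sum>j\<in>X. w \<tau> i j * u j \<tau>)"
        unfolding sum_distrib_right using \<tau> pos
        by (intro sum_mono mult_left_mono stay w_nonneg) auto
      moreover have "(\<Sum>j\<in>X. w \<tau> i j * u j \<tau>) \<le> (\<Sum>j\<in>UNIV. w \<tau> i j * u j \<tau>)"
        using \<tau> pos nonneg by (intro sum_mono2 mult_nonneg_nonneg w_nonneg) auto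
      moreover have "(\<Sum>j\<in>UNIV. w \<tau> i j) * u i \<tau> \<le> d * u i \<tau>"
        using \<tau> pos nonneg by (intro mult_right_mono row_sum) auto
      ultimately show "(\<Sum>j\<in>X. w \<tau> i j) * (c * exp (- d * (\<tau> - s))) - d * u i \<tau>
          \<le> (\<Sum>j\<in>UNIV. w \<tau> i j * (u j \<tau> - u i \<tau>))" by linarith
    qed
    moreover have "(\<Sum>i\<in>-X. (\<Sum>j\<in>X. w \<tau> i j) * (c * exp (- d * (\<tau> - s))) - d * u i \<tau>)
        = (\<Sum>i\<in>-X. \<Sum>j\<in>X. w \<tau> i j) * (c * exp (- d * (\<tau> - s))) - d * ?v \<tau>"
      by (simp only: sum_subtractf sum_distrib_right sum_distrib_left)
    moreover have "a * (c * exp (- d * (\<tau> - s))) \<le>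
        (\<Sum>i\<in>-X. \<Sum>j\<in>X. w \<tau> i j) * (c * exp (- d * (\<tau> - s)))"
      using pos X \<open>0 \<le> c\<close> by (intro mult_right_mono cut) auto
    ultimately show "\<exists>y. (?v has_real_derivative y) (at \<tau>) \<and>
        y \<ge> (a * c) * exp (- d * (\<tau> - s)) - d * ?v \<tau>"
      using der by (intro exI[of _ ?y]) auto
  qed (simp_all add: locally_finite assms(3,4))
  moreover have "?v s \<ge> 0"
    using nonneg by (intro sum_nonneg) auto
  ultimately have "a * c * \<delta> \<le> exp (d * \<delta>) * ?v ?t" by simp
  then have bound: "\<kappa> * c * CARD('m) \<le> ?v ?t"
    by (simp add: \<kappa>_def spread_rate_def exp_minus field_simps)
  \<comment> \<open>Pigeonhole: at most \<open>CARD('m)\<close> nodes share the mass outside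
    \<open>X\<close>, so one of them has at least the average. The receiving node is only known at
    the end of the window.\<close>
  have "\<exists>k\<in>-X. \<kappa> * c \<le> u k ?t"
  proof (rule ccontr)
    assume "\<not> ?thesis"
    then have "?v ?t < (\<Sum>i\<in>-X. \<kappa> * c)"
      using X(2) by (intro sum_strict_mono) (auto simp: not_le)
    also have "\<dots> = card (-X) * (\<kappa> * c)" by simp
    also have "\<dots> \<le> CARD('m) * (\<kappa> * c)"
      using \<open>0 \<le> c\<close> \<open>0 \<le> \<delta>\<close> a_pos
      by (intro mult_right_mono) (auto simp: \<kappa>_def spread_rate_def card_mono)
    finally show False using bound by (simp add: mult.commute)
  qed
  then obtain k where k: "k \<notin> X" "\<kappa> * c \<le> u k ?t" by auto
  have "\<kappa> * c \<le> u i ?t" if "i \<in> X" for i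
  proof -
    have "\<kappa> \<le> exp (- d * \<delta>)"
      using spread_rate_le_exp[OF zero_less_card_finite aD] unfolding \<kappa>_def .
    then have "\<kappa> * c \<le> exp (- d * \<delta>) * c"
      using \<open>0 \<le> c\<close> by (rule mult_right_mono)
    also have "\<dots> \<le> u i ?t" using stay[OF that, of ?t] \<open>0 \<le> \<delta>\<close> by (simp add: mult.commute)
    finally show ?thesis .
  qed
  with k show ?thesis by blast
qed

lemma rate_pos: "0 < \<delta> \<Longrightarrow> 0 < spread_rate CARD('m) a d \<delta>"
  by (simp add: spread_rate_pos a_pos)

lemma rate_le_1:
  assumes "0 < \<delta>" "a * \<delta> \<le> 1"
  shows "spread_rate CARD('m) a d \<delta> \<le> 1"
  by (rule order_trans[OF spread_rate_le_exp]) (use assms d_nonneg in auto)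

text \<open>Starting from the single node \<open>i0\<close>, each window adds a node to the set on
  which the lower bound holds, at the cost of one factor of the rate. After \<open>CARD('m)\<close>
  windows every node is reached.\<close>

lemma spread:
  fixes \<delta> :: real
  assumes u: "solution u" and nonneg: "\<And>i t. t \<ge> s \<Longrightarrow> 0 \<le> u i t"
    and "0 \<le> s" "0 < \<delta>" "a * \<delta> \<le> 1" "0 \<le> c" "c \<le> u i0 s"
  shows "spread_rate CARD('m) a d \<delta> ^ CARD('m) * c \<le> u i (s + CARD('m) * \<delta>)"
proof -
  \<comment> \<open>The alternative \<open>X = UNIV\<close> covers windows that remain after every
    node has been reached; there plain decay of each node preserves the bound.\<close>
  have "\<exists>X. X \<noteq> {} \<and> (X = UNIV \<or> card X > k) \<and> (\<forall>i\<in>X. spread_rate CARD('m) a d \<delta> ^ k * c \<le> u i (s + k * \<delta>))" for k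
  proof (induction k)
    case 0
    show ?case using assms by (intro exI[of _ "{i0}"]) auto
  next
    case (Suc k)
    then obtain X where X: "X \<noteq> {}" "X = UNIV \<or> card X > k"
      "\<And>i. i \<in> X \<Longrightarrow> spread_rate CARD('m) a d \<delta> ^ k * c \<le> u i (s + k * \<delta>)" by auto
    have s: "s \<le> s + k * \<delta>" using \<open>0 < \<delta>\<close> by simp
    have time: "s + Suc k * \<delta> = s + k * \<delta> + \<delta>" by (simp add: algebra_simps)
    have rk: "0 \<le> spread_rate CARD('m) a d \<delta> ^ k * c" using rate_pos[OF \<open>0 < \<delta>\<close>] \<open>0 \<le> c\<close> by simp
    show ?case
    proof (cases "X = UNIV")
      case True
      have "spread_rate CARD('m) a d \<delta> ^ Suc k * c \<le> u i (s + Suc k * \<delta>)" for i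
      proof -
        have "spread_rate CARD('m) a d \<delta> \<le> exp (- d * \<delta>)"
          using spread_rate_le_exp[OF zero_less_card_finite \<open>a * \<delta> \<le> 1\<close>] .
        then have "spread_rate CARD('m) a d \<delta> * (spread_rate CARD('m) a d \<delta> ^ k * c) \<le> exp (- d * \<delta>) * u i (s + k * \<delta>)"
          using rk X True by (intro mult_mono) auto
        also have "\<dots> \<le> u i (s + k * \<delta> + \<delta>)"
          using node_decay[OF u, of "s + k * \<delta>" "s + k * \<delta> + \<delta>" i] nonneg s assms(3,4) by auto
        finally show ?thesis by (simp only: time power_Suc mult.assoc)
      qed
      then show ?thesis by (intro exI[of _ UNIV]) blast
    next
      case False
      have "\<exists>l. l \<notin> X \<and> (\<forall>i\<in>insert l X.
          spread_rate CARD('m) a d \<delta> * (spread_rate CARD('m) a d \<delta> ^ k * c) \<le> u i (s + k * \<delta> + \<delta>))"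
      proof (rule spread_step[OF u])
        show "0 \<le> u i t" if "s + k * \<delta> \<le> t" for i t
          using that s by (intro nonneg) linarith
      qed (use s assms(3-5) X rk False in auto)
      then obtain l where l: "l \<notin> X"
        "\<And>i. i \<in> insert l X \<Longrightarrow> spread_rate CARD('m) a d \<delta> * (spread_rate CARD('m) a d \<delta> ^ k * c) \<le> u i (s + k * \<delta> + \<delta>)"
        by blast
      have "card (insert l X) > Suc k" using X(2) False l(1) by simp
      with l(2) show ?thesis
        by (intro exI[of _ "insert l X"]) (auto simp only: time power_Suc mult.assoc)
    qed
  qed
  from this[of "CARD('m)"] obtain X where X: "X = UNIV \<or> card X > CARD('m)"
    "\<forall>i\<in>X. spread_rate CARD('m) a d \<delta> ^ CARD('m) * c \<le> u i (s + CARD('m) * \<delta>)" by blast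
  then have "X = UNIV" using card_mono[of UNIV X] by auto
  with X show ?thesis by auto
qed

section \<open>Contraction of the range and exponential decay\<close>

lemma range_invariant:
  assumes "solution z" "0 \<le> s" "s \<le> t" "\<And>i. lo \<le> z i s \<and> z i s \<le> hi"
  shows "lo \<le> z i t \<and> z i t \<le> hi"
  using nonneg_invariant[OF solution_diff_const[OF assms(1), of lo] assms(2,3)]
    nonneg_invariant[OF solution_const_diff[OF assms(1), of hi] assms(2,3)] assms(4)
  by (simp add: algebra_simps)

text \<open>Split at the midpoint. If some node lies in the upper half, its distance from
  \<open>lo\<close> spreads and lifts the lower end; otherwise all nodes lie in the lower half and
  the upper end drops at once. The second gain is weakened to match the first, giving one
  contraction factor.\<close>

lemma range_contraction:
  fixes \<delta> :: real
  assumes z: "solution z" and s: "0 \<le> s" and \<delta>: "0 < \<delta>" "a * \<delta> \<le> 1"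
    and init: "\<And>i. lo \<le> z i s \<and> z i s \<le> hi"
  shows "\<exists>lo' hi'. hi' - lo' = (1 - spread_rate CARD('m) a d \<delta> ^ CARD('m) / 2) * (hi - lo) \<and>
    (\<forall>i. lo' \<le> z i (s + CARD('m) * \<delta>) \<and> z i (s + CARD('m) * \<delta>) \<le> hi')"
proof -
  let ?c = "(hi - lo) / 2" and ?q = "spread_rate CARD('m) a d \<delta> ^ CARD('m)" and ?t = "s + CARD('m) * \<delta>"
  have t: "s \<le> ?t" using \<delta> by simp
  have q: "0 \<le> ?q" "?q \<le> 1"
    using rate_pos[OF \<delta>(1)] rate_le_1[OF \<delta>] by (auto intro: power_le_one)
  \<comment> \<open>Any node witnesses \<open>lo \<le> hi\<close>; \<open>undefined\<close> merely
    names one.\<close>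
  have c: "0 \<le> ?c" using init[of undefined] by simp
  show ?thesis
  proof (cases "\<exists>i. ?c \<le> z i s - lo")
    case True
    then obtain i0 where i0: "?c \<le> z i0 s - lo" ..
    have "?q * ?c \<le> z i ?t - lo" for i
      by (rule spread[OF solution_diff_const[OF z] _ s \<delta> c i0])
        (use range_invariant[OF z s _ init] in auto)
    moreover have "z i ?t \<le> hi" for i
      using range_invariant[OF z s t init] by blast
    ultimately show ?thesis
      by (intro exI[of _ "lo + ?q * ?c"] exI[of _ hi]) (auto simp: algebra_simps)
  next
    case False
    have "lo \<le> z i s \<and> z i s \<le> hi - ?c" for i
    proof -
      have "z i s - lo < ?c" using False by (meson not_le)
      then show ?thesis using init[of i] by (simp add: field_simps)
    qed
    then have "lo \<le> z i ?t \<and> z i ?t \<le> hi - ?c" for i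
      by (rule range_invariant[OF z s t])
    moreover have "?q * ?c \<le> ?c" using q(2) c by (simp add: mult_left_le_one_le q(1))
    ultimately have "lo \<le> z i ?t \<and> z i ?t \<le> hi - ?q * ?c" for i
      by (meson diff_left_mono order_trans)
    then show ?thesis
      by (intro exI[of _ lo] exI[of _ "hi - ?q * ?c"]) (auto simp: algebra_simps)
  qed
qed

text \<open>Iterate the contraction over the complete windows before \<open>t\<close>, starting from
  the interval from \<open>-R\<close> to \<open>R\<close>. The factor 4 is the initial width
  \<open>2 * R\<close> times 2 for rounding the number of windows down.\<close>

lemma exponential_decay:
  fixes \<delta> :: real
  assumes z: "solution z" and \<delta>: "0 < \<delta>" "a * \<delta> \<le> 1" and "0 \<le> t"
    and init: "\<And>i. \<bar>z i 0\<bar> \<le> R"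
  shows "\<bar>z i t - z j t\<bar> \<le>
    4 * R * exp (ln (1 - spread_rate CARD('m) a d \<delta> ^ CARD('m) / 2) * (t / (CARD('m) * \<delta>)))"
proof -
  let ?T = "CARD('m) * \<delta>"
  define q where "q = 1 - spread_rate CARD('m) a d \<delta> ^ CARD('m) / 2"
  have rate: "spread_rate CARD('m) a d \<delta> ^ CARD('m) \<le> 1" "0 \<le> spread_rate CARD('m) a d \<delta> ^ CARD('m)"
    using rate_pos[OF \<delta>(1)] rate_le_1[OF \<delta>] by (auto intro: power_le_one)
  then have q: "1/2 \<le> q" "q \<le> 1" by (auto simp: q_def)
  have R: "0 \<le> R" using init[of i] by linarith
  have T: "0 < ?T" using \<delta> by simp
  have iter: "\<exists>lo hi. hi - lo = q ^ k * (2 * R) \<and> (\<forall>i. lo \<le> z i (k * ?T) \<and> z i (k * ?T) \<le> hi)" for k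
  proof (induction k)
    case 0
    show ?case using init by (intro exI[of _ "-R"] exI[of _ R]) (auto simp: abs_le_iff minus_le_iff)
  next
    case (Suc k)
    then obtain lo hi where lh: "hi - lo = q ^ k * (2 * R)"
      "\<And>i. lo \<le> z i (k * ?T) \<and> z i (k * ?T) \<le> hi" by blast
    have "0 \<le> k * ?T" using T by simp
    from range_contraction[OF z this \<delta> lh(2)] obtain lo' hi' where
      "hi' - lo' = q * (hi - lo)" "\<forall>i. lo' \<le> z i (k * ?T + ?T) \<and> z i (k * ?T + ?T) \<le> hi'"
      unfolding q_def by blast
    moreover have "Suc k * ?T = k * ?T + ?T" by (simp add: algebra_simps)
    ultimately show ?case
      by (intro exI[of _ lo'] exI[of _ hi']) (simp add: lh(1) del: of_nat_Suc)
  qed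
  define k where "k = nat \<lfloor>t / ?T\<rfloor>"
  have kx: "real k \<le> t / ?T" "t / ?T < real k + 1"
    using T \<open>0 \<le> t\<close> by (auto simp: k_def)
  then have kt: "k * ?T \<le> t" using T by (simp add: field_simps)
  obtain lo hi where lh: "hi - lo = q ^ k * (2 * R)"
    "\<And>i. lo \<le> z i (k * ?T) \<and> z i (k * ?T) \<le> hi" using iter by blast
  have "0 \<le> k * ?T" using T by simp
  then have "lo \<le> z l t \<and> z l t \<le> hi" for l
    by (rule range_invariant[OF z _ kt lh(2)])
  from this[of i] this[of j] have "\<bar>z i t - z j t\<bar> \<le> q ^ k * (2 * R)"
    using lh(1) by linarith
  \<comment> \<open>As \<open>k + 1\<close> exceeds \<open>t / ?T\<close> and \<open>q\<close> is at
    most 1, \<open>q ^ (k + 1)\<close> is below the exponential; the missing factor \<open>q\<close>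
    is at least 1/2, which costs the 2.\<close>
  also have "q ^ k \<le> 2 * exp (ln q * (t / ?T))"
  proof -
    have "ln q \<le> 0" using q by simp
    then have "ln q * (real k + 1) \<le> ln q * (t / ?T)"
      using kx(2) by (intro mult_left_mono_neg) auto
    then have "exp (ln q * (real k + 1)) \<le> exp (ln q * (t / ?T))" by simp
    moreover have "exp (ln q * (real k + 1)) = q ^ k * q"
      using q by (simp add: distrib_left exp_add exp_of_nat_mult mult.commute[of "ln q"])
    moreover have "q ^ k * (1/2) \<le> q ^ k * q"
      using q by (intro mult_left_mono) auto
    ultimately show ?thesis by linarith
  qed
  then have "q ^ k * (2 * R) \<le> 2 * exp (ln q * (t / ?T)) * (2 * R)"
    using R by (intro mult_right_mono) auto
  finally show ?thesis by (simp add: q_def mult_ac)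
qed

text \<open>The common factor \<open>exp (- l * t)\<close> removes the term
  \<open>l * y i t\<close>. The weights being real, real and imaginary parts then average
  separately, and the bounds with 4 add up to 8. Restoring the factor contributes
  \<open>Re l * t\<close>.\<close>

lemma complex_exponential_decay:
  fixes \<delta> :: real and y :: "'m \<Rightarrow> real \<Rightarrow> complex"
  assumes cont: "\<And>i. continuous_on {0..} (y i)"
    and deriv: "\<And>i t. t > 0 \<Longrightarrow> t \<notin> D \<Longrightarrow> (y i has_vector_derivative
      (l * y i t + (\<Sum>j\<in>UNIV. complex_of_real (w t i j) * (y j t - y i t)))) (at t)"
    and \<delta>: "0 < \<delta>" "a * \<delta> \<le> 1" and "0 \<le> t" and init: "\<And>i. norm (y i 0) \<le> R"
  shows "norm (y i t - y j t) \<le>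
    8 * R * exp (Re l * t + ln (1 - spread_rate CARD('m) a d \<delta> ^ CARD('m) / 2) * (t / (CARD('m) * \<delta>)))"
proof -
  define z where "z i t = exp (t *\<^sub>R (- l)) * y i t" for i t
  have z_deriv: "(z i has_vector_derivative (\<Sum>j\<in>UNIV. complex_of_real (w t i j) * (z j t - z i t))) (at t)"
    if "t > 0" "t \<notin> D" for i t
  proof -
    have "(z i has_vector_derivative (exp (t *\<^sub>R (- l)) * (l * y i t + (\<Sum>j\<in>UNIV. complex_of_real (w t i j) * (y j t - y i t)))
        + exp (t *\<^sub>R (- l)) * (- l) * y i t)) (at t)"
      unfolding z_def
      by (rule has_vector_derivative_mult[OF exp_scaleR_has_vector_derivative_right deriv[OF that]])
    also have "exp (t *\<^sub>R (- l)) * (l * y i t + (\<Sum>j\<in>UNIV. complex_of_real (w t i j) * (y j t - y i t)))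
        + exp (t *\<^sub>R (- l)) * (- l) * y i t = (\<Sum>j\<in>UNIV. complex_of_real (w t i j) * (z j t - z i t))"
      by (simp add: z_def sum_distrib_left algebra_simps)
    finally show ?thesis .
  qed
  have z_cont: "continuous_on {0..} (z i)" for i
    unfolding z_def by (intro continuous_intros cont)
  have Re: "solution (\<lambda>i t. Re (z i t))"
    unfolding solution_def
  proof (intro conjI allI impI)
    show "((\<lambda>t. Re (z i t)) has_real_derivative (\<Sum>j\<in>UNIV. w t i j * (Re (z j t) - Re (z i t)))) (at t)"
      if "0 < t" "t \<notin> D" for i t
      using bounded_linear.has_vector_derivative[OF bounded_linear_Re z_deriv[OF that]]
      by (simp add: has_real_derivative_iff_has_vector_derivative)
  qed (intro continuous_intros z_cont)
  have Im: "solution (\<lambda>i t. Im (z i t))"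
    unfolding solution_def
  proof (intro conjI allI impI)
    show "((\<lambda>t. Im (z i t)) has_real_derivative (\<Sum>j\<in>UNIV. w t i j * (Im (z j t) - Im (z i t)))) (at t)"
      if "0 < t" "t \<notin> D" for i t
      using bounded_linear.has_vector_derivative[OF bounded_linear_Im z_deriv[OF that]]
      by (simp add: has_real_derivative_iff_has_vector_derivative)
  qed (intro continuous_intros z_cont)
  have z0: "z i 0 = y i 0" for i by (simp add: z_def)
  let ?e = "exp (ln (1 - spread_rate CARD('m) a d \<delta> ^ CARD('m) / 2) * (t / (CARD('m) * \<delta>)))"
  have "\<bar>Re (z i t) - Re (z j t)\<bar> \<le> 4 * R * ?e"
    by (rule exponential_decay[OF Re \<delta> \<open>0 \<le> t\<close>])
      (use init in \<open>auto simp: z0 intro: order_trans[OF abs_Re_le_cmod]\<close>)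
  moreover have "\<bar>Im (z i t) - Im (z j t)\<bar> \<le> 4 * R * ?e"
    by (rule exponential_decay[OF Im \<delta> \<open>0 \<le> t\<close>])
      (use init in \<open>auto simp: z0 intro: order_trans[OF abs_Im_le_cmod]\<close>)
  ultimately have z_bound: "norm (z i t - z j t) \<le> 8 * R * ?e"
    using cmod_le[of "z i t - z j t"] by simp
  have "y i t - y j t = exp (t *\<^sub>R l) * (z i t - z j t)"
    by (simp add: z_def right_diff_distrib mult.assoc[symmetric] exp_add[symmetric])
  then have "norm (y i t - y j t) = exp (Re l * t) * norm (z i t - z j t)"
    by (simp add: norm_mult mult.commute)
  also have "\<dots> \<le> exp (Re l * t) * (8 * R * ?e)"
    using z_bound by (intro mult_left_mono) auto
  finally show ?thesis by (simp add: exp_add mult_ac)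
qed

end

section \<open>Cuts of strongly connected graphs\<close>

text \<open>A path from inside \<open>X\<close> to outside must cross the boundary. Edges run from
  \<open>j\<close> to \<open>i\<close> when \<open>\<alpha> i j\<close> is positive, so the crossing
  weight has its second index in \<open>X\<close>.\<close>

lemma strongly_connected_cut_edge:
  assumes "strongly_connected \<alpha>" "X \<noteq> {}" "X \<noteq> UNIV"
  shows "\<exists>i j. i \<notin> X \<and> j \<in> X \<and> \<alpha> i j > 0"
proof (rule ccontr)
  assume no_edge: "\<not> ?thesis"
  obtain x y where "x \<in> X" "y \<notin> X" using assms by auto
  have "(x, y) \<in> (edges \<alpha>)\<^sup>*" using assms(1) by (simp add: strongly_connected_def)
  then have "y \<in> X"
  proof (induction rule: rtrancl_induct)
    case (step y z)
    then show ?case using no_edge unfolding edges_def by blast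
  qed (rule \<open>x \<in> X\<close>)
  with \<open>y \<notin> X\<close> show False ..
qed

lemma cut_weight_ge:
  fixes \<beta> :: "'m::finite \<Rightarrow> 'm \<Rightarrow> real"
  assumes "weighted_digraph \<beta>" "strongly_connected \<beta>" "X \<noteq> {}" "X \<noteq> UNIV"
    and "\<And>i j. i \<noteq> j \<Longrightarrow> \<beta> i j > 0 \<Longrightarrow> a \<le> \<beta> i j"
  shows "a \<le> (\<Sum>i\<in>-X. \<Sum>j\<in>X. \<beta> i j)"
proof -
  obtain i j where ij: "i \<notin> X" "j \<in> X" "\<beta> i j > 0"
    using strongly_connected_cut_edge[OF assms(2-4)] by blast
  have nonneg: "0 \<le> \<beta> k l" if "k \<in> -X" "l \<in> X" for k l
  proof -
    have "k \<noteq> l" using that by blast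
    then show ?thesis using assms(1) by (simp add: weighted_digraph_def)
  qed
  have "i \<noteq> j" using ij by blast
  then have "a \<le> \<beta> i j" using ij(3) by (rule assms(5))
  also have "\<dots> \<le> (\<Sum>j\<in>X. \<beta> i j)"
    by (rule member_le_sum) (simp_all add: ij nonneg)
  also have "\<dots> \<le> (\<Sum>i\<in>-X. \<Sum>j\<in>X. \<beta> i j)"
    by (rule member_le_sum) (simp_all add: ij nonneg sum_nonneg)
  finally show ?thesis .
qed

section \<open>Coordinates of trajectories\<close>

lemma diag_mat_mult_nth: "(diag_mat d *v x) $ k = d k * x $ k"
  by (simp add: diag_mat_def matrix_vector_mult_def mult_delta_left)

lemma norm_vec_le_sum: "norm (x :: 'a::real_normed_vector ^ 'n::finite) \<le> (\<Sum>k\<in>UNIV. norm (x $ k))"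
  unfolding norm_vec_def by (rule L2_set_le_sum) simp

text \<open>The gain \<open>g k\<close> multiplies both the cut weight and the degree bound. Windows
  of length \<open>1 / g k\<close> compensate this exactly, so the contraction per window is
  independent of the gain and only the number of windows, proportional to \<open>g k * t\<close>,
  grows.\<close>

lemma trajectory_component_bound:
  fixes lam :: "'n::finite \<Rightarrow> complex" and \<alpha> :: "real \<Rightarrow> 'm::finite \<Rightarrow> 'm \<Rightarrow> real"
  assumes traj: "trajectory (diag_mat lam) (diag_mat (\<lambda>k. complex_of_real (g k))) \<alpha> x"
    and a: "0 < a" "a \<le> 1" and "0 < g k"
    and graphs: "\<And>t. 0 \<le> t \<Longrightarrow> weighted_digraph (\<alpha> t)" "\<And>t. 0 \<le> t \<Longrightarrow> strongly_connected (\<alpha> t)"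
    and weights: "\<And>t i j. 0 \<le> t \<Longrightarrow> i \<noteq> j \<Longrightarrow> \<alpha> t i j > 0 \<Longrightarrow> a \<le> \<alpha> t i j"
    and degrees: "\<And>t i. 0 \<le> t \<Longrightarrow> (\<Sum>j\<in>UNIV - {i}. \<alpha> t i j) \<le> d"
    and "0 \<le> t"
  shows "norm (x i t $ k - x j t $ k) \<le> 8 * Max (range (\<lambda>i. norm (x i 0))) *
    exp (Re (lam k) * t + ln (1 - spread_rate CARD('m) a d 1 ^ CARD('m) / 2) / CARD('m) * g k * t)"
proof -
  obtain D where D: "\<forall>T. finite (D \<inter> {0..T})"
    and "\<forall>t\<in>{0..} - D. \<forall>i. (x i has_vector_derivative
      (diag_mat lam *v x i t + diag_mat (\<lambda>k. complex_of_real (g k)) *v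
        (\<Sum>j\<in>UNIV. \<alpha> t i j *\<^sub>R (x j t - x i t)))) (at t within {0..})"
    using traj unfolding trajectory_def by blast
  then have deriv: "(x i has_vector_derivative
      (diag_mat lam *v x i t + diag_mat (\<lambda>k. complex_of_real (g k)) *v
        (\<Sum>j\<in>UNIV. \<alpha> t i j *\<^sub>R (x j t - x i t)))) (at t within {0..})"
    if "0 \<le> t" "t \<notin> D" for t i
    using that by (auto simp only: Diff_iff atLeast_iff)
  \<comment> \<open>Diagonal values of \<open>\<alpha>\<close> are arbitrary, possibly negative, and
    multiply a zero difference; setting them to 0 yields nonnegative weights with the same
    dynamics.\<close>
  define w where "w t i j = (if i = j then 0 else g k * \<alpha> t i j)" for t i j
  have w_row: "(\<Sum>j\<in>UNIV. w t i j) = g k * (\<Sum>j\<in>UNIV - {i}. \<alpha> t i j)" for t i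
  proof -
    have "(\<Sum>j\<in>UNIV. w t i j) = (\<Sum>j\<in>UNIV - {i}. w t i j)"
      by (rule sum.mono_neutral_right) (auto simp: w_def)
    also have "\<dots> = (\<Sum>j\<in>UNIV - {i}. g k * \<alpha> t i j)"
      by (rule sum.cong) (auto simp: w_def)
    finally show ?thesis by (simp add: sum_distrib_left)
  qed
  interpret averaging w "g k * a" "g k * d" D
  proof
    fix t :: real assume t: "t \<ge> 0"
    show "0 \<le> w t i j" for i j
      using graphs(1)[OF t] \<open>0 < g k\<close> by (simp add: w_def weighted_digraph_def)
    show "(\<Sum>j\<in>UNIV. w t i j) \<le> g k * d" for i
      unfolding w_row using degrees[OF t, of i] \<open>0 < g k\<close> by (intro mult_left_mono) auto
    fix X :: "'m set" assume X: "X \<noteq> {}" "X \<noteq> UNIV"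
    have "(\<Sum>i\<in>-X. \<Sum>j\<in>X. w t i j) = (\<Sum>i\<in>-X. \<Sum>j\<in>X. g k * \<alpha> t i j)"
      by (intro sum.cong refl) (auto simp: w_def)
    also have "\<dots> = g k * (\<Sum>i\<in>-X. \<Sum>j\<in>X. \<alpha> t i j)"
      by (simp add: sum_distrib_left)
    finally show "g k * a \<le> (\<Sum>i\<in>-X. \<Sum>j\<in>X. w t i j)"
      using cut_weight_ge[OF graphs[OF t] X weights[OF t]] \<open>0 < g k\<close> by simp
  qed (use a \<open>0 < g k\<close> D in auto)
  let ?R = "Max (range (\<lambda>i. norm (x i 0)))"
  have "norm (x i t $ k - x j t $ k) \<le> 8 * ?R * exp (Re (lam k) * t +
      ln (1 - spread_rate CARD('m) (g k * a) (g k * d) (1 / g k) ^ CARD('m) / 2) * (t / (CARD('m) * (1 / g k))))"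
  proof (rule complex_exponential_decay[where y = "\<lambda>i t. x i t $ k"])
    show "continuous_on {0..} (\<lambda>t. x i t $ k)" for i
      by (intro continuous_on_component) (use traj in \<open>simp only: trajectory_def\<close>)
    fix i and t :: real assume t: "0 < t" "t \<notin> D"
    have at: "at t within {0..} = at t"
      using t by (intro at_within_interior) (simp add: interior_real_atLeast)
    have "((\<lambda>t. x i t $ k) has_vector_derivative
      (diag_mat lam *v x i t + diag_mat (\<lambda>k. complex_of_real (g k)) *v
        (\<Sum>j\<in>UNIV. \<alpha> t i j *\<^sub>R (x j t - x i t))) $ k) (at t)"
      by (rule bounded_linear.has_vector_derivative[OF bounded_linear_vec_nth
          deriv[OF less_imp_le[OF t(1)] t(2), unfolded at]])
    moreover have "complex_of_real (g k) * (\<alpha> t i j *\<^sub>R (x j t $ k - x i t $ k)) =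
        complex_of_real (w t i j) * (x j t $ k - x i t $ k)" for j
      by (simp add: w_def scaleR_conv_of_real)
    ultimately show "((\<lambda>t. x i t $ k) has_vector_derivative (lam k * x i t $ k +
        (\<Sum>j\<in>UNIV. complex_of_real (w t i j) * (x j t $ k - x i t $ k)))) (at t)"
      by (simp add: diag_mat_mult_nth sum_distrib_left)
  next
    fix i show "norm (x i 0 $ k) \<le> ?R"
      by (rule order_trans[OF Finite_Cartesian_Product.norm_nth_le Max_ge]) auto
  qed (use a \<open>0 < g k\<close> \<open>0 \<le> t\<close> in simp_all)
  moreover have "spread_rate CARD('m) (g k * a) (g k * d) (1 / g k) = spread_rate CARD('m) a d 1"
    using \<open>0 < g k\<close> by (simp add: spread_rate_def)
  moreover have "c * (t / (CARD('m) * (1 / g k))) = c / CARD('m) * g k * t" for c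
    by simp
  ultimately show ?thesis by (simp only:)
qed

section \<open>Constants uniform over the finite family of Laplacians\<close>

lemma uniform_weight_bounds:
  fixes L :: "nat \<Rightarrow> real^'m::finite^'m"
  obtains a d where "0 < a" "a \<le> 1"
    and "\<And>p i j. p \<in> {1..v} \<Longrightarrow> - L p $ i $ j > 0 \<Longrightarrow> a \<le> - L p $ i $ j"
    and "\<And>p i. p \<in> {1..v} \<Longrightarrow> L p $ i $ i \<le> d"
proof
  let ?W = "(\<lambda>(p, i, j). - L p $ i $ j) ` ({1..v} \<times> UNIV \<times> UNIV)"
  \<comment> \<open>The inserted 1 makes the minimum exist even without positive weights and ensures
    \<open>a \<le> 1\<close>, as windows of length \<open>1 / g k\<close> require.\<close>
  let ?E = "insert 1 {c \<in> ?W. c > 0}"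
  have fin: "finite ?E" by auto
  then show "0 < Min ?E" by (subst Min_gr_iff) auto
  show "Min ?E \<le> 1" using fin by (intro Min_le) auto
  show "Min ?E \<le> - L p $ i $ j" if "p \<in> {1..v}" "- L p $ i $ j > 0" for p i j
    using fin by (rule Min_le) (use that in \<open>auto intro!: image_eqI[of _ _ "(p, i, j)"]\<close>)
  show "L p $ i $ i \<le> (\<Sum>p\<in>{1..v}. \<Sum>i\<in>UNIV. \<bar>L p $ i $ i\<bar>)" if "p \<in> {1..v}" for p i
  proof -
    have "L p $ i $ i \<le> \<bar>L p $ i $ i\<bar>" by simp
    also have "\<dots> \<le> (\<Sum>i\<in>UNIV. \<bar>L p $ i $ i\<bar>)" by (rule member_le_sum) auto
    also have "\<dots> \<le> (\<Sum>p\<in>{1..v}. \<Sum>i\<in>UNIV. \<bar>L p $ i $ i\<bar>)"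
      using that by (intro member_le_sum[of p] sum_nonneg) auto
    finally show ?thesis .
  qed
qed

text \<open>Off-diagonal Laplacian entries determine the weights, and both graph properties ignore
  the diagonal.\<close>

lemma laplacian_eq_imp_graph:
  assumes eq: "laplacian \<alpha> = laplacian \<beta>" and \<beta>: "weighted_digraph \<beta>" "strongly_connected \<beta>"
  shows "weighted_digraph \<alpha>" "strongly_connected \<alpha>"
proof -
  have off: "\<alpha> i j = \<beta> i j" if "i \<noteq> j" for i j
    using arg_cong[OF eq, of "\<lambda>M. M $ i $ j"] that by (simp add: laplacian_def)
  show "weighted_digraph \<alpha>"
    using \<beta>(1) off by (simp add: weighted_digraph_def)
  have "edges \<alpha> = edges \<beta>"
    using off by (auto simp: edges_def)
  then show "strongly_connected \<alpha>"
    using \<beta>(2) by (simp add: strongly_connected_def)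
qed

section \<open>The gain threshold and exponential consensus\<close>

theorem theorem3:
  fixes A :: "real^'n::{finite,linorder}^'n::{finite,linorder}"
    and B :: "real^'b^'n::{finite,linorder}"
    and Q S :: "complex^'n::{finite,linorder}^'n::{finite,linorder}"
    and lam :: "'n \<Rightarrow> complex"
    and L :: "nat \<Rightarrow> real^'m^'m"
    and r v :: nat
    and h :: real
  assumes "CARD('m) \<ge> 2"
    and "CARD('b) < CARD('n)"
    and "diagonalizable_over_C A"
    and "num_unstable_eigenvalues A = r" and "r \<ge> 1"
    and "stabilizable A B"
    and "invertible Q" and "\<forall>k. is_eigenvector (cmat A) (column k Q)"
    and "S = matrix_inv Q ** cmat A ** Q" and "S = diag_mat lam"
    and "\<forall>k l. k \<le> l \<longrightarrow> Re (lam k) \<ge> Re (lam l)"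
    and "\<forall>k. position k \<le> r \<longrightarrow> Re (lam k) > 0"
    and "\<forall>k. position k > r \<longrightarrow> Re (lam k) \<le> 0"
    and "\<forall>p\<in>{1..v}. \<exists>\<alpha>. weighted_digraph \<alpha> \<and> strongly_connected \<alpha> \<and> L p = laplacian \<alpha>"
    and "h > 0"
  shows "\<exists>\<gamma>\<^sub>0>0. \<forall>\<gamma>\<ge>\<gamma>\<^sub>0. \<forall>\<sigma> (\<alpha> :: real \<Rightarrow> 'm \<Rightarrow> 'm \<Rightarrow> real).
           admissible_signal v h \<sigma> \<longrightarrow> (\<forall>t\<ge>0. laplacian (\<alpha> t) = L (\<sigma> t)) \<longrightarrow>
           consensus_exponentially S (gain_matrix r \<gamma>) \<alpha>"
proof -
  obtain a d where a: "0 < a" "a \<le> 1"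
    and off_diag: "\<And>p i j. p \<in> {1..v} \<Longrightarrow> - L p $ i $ j > 0 \<Longrightarrow> a \<le> - L p $ i $ j"
    and diag: "\<And>p i. p \<in> {1..v} \<Longrightarrow> L p $ i $ i \<le> d"
    using uniform_weight_bounds by blast
  \<comment> \<open>The bound \<open>d\<close> comes without a sign; \<open>\<bar>d\<bar>\<close>
    still bounds the degrees and makes the exponential in the rate at most 1.\<close>
  define q where "q = spread_rate CARD('m) a \<bar>d\<bar> 1 ^ CARD('m)"
  \<comment> \<open>Decay rate per unit of gain: a contraction by \<open>1 - q / 2\<close> takes
    \<open>CARD('m)\<close> windows.\<close>
  define \<mu> where "\<mu> = - ln (1 - q / 2) / CARD('m)"
  have "spread_rate CARD('m) a \<bar>d\<bar> 1 \<le> exp (- \<bar>d\<bar> * 1)"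
    using a by (intro spread_rate_le_exp) auto
  also have "\<dots> \<le> 1" by simp
  finally have "spread_rate CARD('m) a \<bar>d\<bar> 1 \<le> 1" .
  moreover have "0 < spread_rate CARD('m) a \<bar>d\<bar> 1"
    using a by (intro spread_rate_pos) auto
  ultimately have q: "0 < q" "q \<le> 1"
    unfolding q_def by (auto intro: power_le_one)
  then have \<mu>: "0 < \<mu>"
    by (simp add: \<mu>_def divide_neg_pos)
  \<comment> \<open>The sum dominates every \<open>\<bar>Re (lam k)\<bar>\<close>, and the summand 1
    leaves a margin of \<open>\<mu>\<close>.\<close>
  define \<gamma>0 where "\<gamma>0 = 1 + (\<Sum>k\<in>UNIV. \<bar>Re (lam k)\<bar>) / \<mu>"
  have \<gamma>0_ge: "\<bar>Re (lam k)\<bar> + \<mu> \<le> \<mu> * \<gamma>0" for k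
  proof -
    have "\<bar>Re (lam k)\<bar> \<le> (\<Sum>k\<in>UNIV. \<bar>Re (lam k)\<bar>)"
      by (rule member_le_sum) auto
    then show ?thesis using \<mu> by (simp add: \<gamma>0_def field_simps)
  qed
  have \<gamma>0_pos: "\<gamma>0 > 0"
    using \<mu> by (auto simp: \<gamma>0_def intro!: add_pos_nonneg divide_nonneg_pos sum_nonneg)
  show ?thesis
  proof (intro exI[of _ \<gamma>0] conjI allI impI \<gamma>0_pos)
    fix \<gamma> \<sigma> and \<alpha> :: "real \<Rightarrow> 'm \<Rightarrow> 'm \<Rightarrow> real"
    assume \<gamma>: "\<gamma>0 \<le> \<gamma>" and \<sigma>: "admissible_signal v h \<sigma>"
      and \<alpha>: "\<forall>t\<ge>0. laplacian (\<alpha> t) = L (\<sigma> t)"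
    define g where "g k = (if position k \<le> r then \<gamma> else 1)" for k :: 'n
    have g_pos: "0 < g k" for k
      using \<gamma> \<gamma>0_pos by (simp add: g_def)
    have gain: "gain_matrix r \<gamma> = diag_mat (\<lambda>k. complex_of_real (g k))"
      by (simp add: gain_matrix_def g_def)
    \<comment> \<open>Unstable coordinates are beaten by the threshold on \<open>\<gamma>\<close>;
      in the others the gain is 1 and \<open>Re (lam k)\<close> is nonpositive, so
      \<open>- \<mu>\<close> remains.\<close>
    have rate: "Re (lam k) - \<mu> * g k \<le> - \<mu>" for k
    proof (cases "position k \<le> r")
      case True
      have "\<mu> * \<gamma>0 \<le> \<mu> * \<gamma>" using \<gamma> \<mu> by simp
      then show ?thesis using True \<gamma>0_ge[of k] by (simp add: g_def)
    next
      case False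
      then show ?thesis using assms(13) by (simp add: g_def)
    qed
    have \<sigma>_mem: "\<sigma> t \<in> {1..v}" if "0 \<le> t" for t
      using \<sigma> that by (simp add: admissible_signal_def)
    have graph: "weighted_digraph (\<alpha> t)" "strongly_connected (\<alpha> t)" if t: "0 \<le> t" for t
    proof -
      obtain \<beta> where \<beta>: "weighted_digraph \<beta>" "strongly_connected \<beta>" "L (\<sigma> t) = laplacian \<beta>"
        using assms(14) \<sigma>_mem[OF t] by blast
      have "laplacian (\<alpha> t) = laplacian \<beta>" using \<alpha> t \<beta>(3) by simp
      from laplacian_eq_imp_graph[OF this \<beta>(1,2)]
      show "weighted_digraph (\<alpha> t)" "strongly_connected (\<alpha> t)" .
    qed
    have weight: "a \<le> \<alpha> t i j" if "0 \<le> t" "i \<noteq> j" "\<alpha> t i j > 0" for t i j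
    proof -
      have "- L (\<sigma> t) $ i $ j = \<alpha> t i j"
        using that(2) by (simp add: laplacian_def flip: \<alpha>[rule_format, OF that(1)])
      then show ?thesis using off_diag[OF \<sigma>_mem[OF that(1)], of i j] that(3) by simp
    qed
    have degree: "(\<Sum>j\<in>UNIV - {i}. \<alpha> t i j) \<le> \<bar>d\<bar>" if "0 \<le> t" for t i
    proof -
      have "L (\<sigma> t) $ i $ i = (\<Sum>j\<in>UNIV - {i}. \<alpha> t i j)"
        by (simp add: laplacian_def flip: \<alpha>[rule_format, OF that])
      then show ?thesis using diag[OF \<sigma>_mem[OF that], of i] by simp
    qed
    show "consensus_exponentially S (gain_matrix r \<gamma>) \<alpha>"
      unfolding consensus_exponentially_def gain \<open>S = diag_mat lam\<close>
    \<comment> \<open>The norm is at most the sum over \<open>CARD('n)\<close> coordinates, each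
      contributing the constant 8.\<close>
    proof (rule exI[of _ "8 * real CARD('n)"], intro conjI exI[of _ \<mu>] allI impI \<mu>)
      fix x t i j
      assume traj: "trajectory (diag_mat lam) (diag_mat (\<lambda>k. complex_of_real (g k))) \<alpha> x"
        and t: "0 \<le> (t::real)"
      let ?R = "Max (range (\<lambda>i. norm (x i 0)))"
      have R: "0 \<le> ?R"
        by (rule order_trans[OF norm_ge_zero[of "x i 0"]], rule Max_ge) auto
      have "norm ((x i t - x j t) $ k) \<le> 8 * ?R * exp (- \<mu> * t)" for k
      proof -
        have "norm ((x i t - x j t) $ k) \<le> 8 * ?R * exp (Re (lam k) * t +
            ln (1 - spread_rate CARD('m) a \<bar>d\<bar> 1 ^ CARD('m) / 2) / CARD('m) * g k * t)"
          using trajectory_component_bound[where g = g, OF traj a g_pos graph weight degree t] by simp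
        also have "\<dots> = 8 * ?R * exp ((Re (lam k) - \<mu> * g k) * t)"
          by (simp add: \<mu>_def q_def algebra_simps)
        also have "\<dots> \<le> 8 * ?R * exp (- \<mu> * t)"
          using R mult_right_mono[OF rate[of k] t] by (intro mult_left_mono) auto
        finally show ?thesis .
      qed
      then have "(\<Sum>k\<in>UNIV. norm ((x i t - x j t) $ k)) \<le> (\<Sum>k\<in>(UNIV::'n set). 8 * ?R * exp (- \<mu> * t))"
        by (rule sum_mono)
      then show "norm (x i t - x j t) \<le> 8 * real CARD('n) * exp (- \<mu> * t) * ?R"
        using norm_vec_le_sum[of "x i t - x j t"] by (simp add: mult_ac)
    qed simp
  qed
qed

end
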